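(* Let $\mathcal{Q}$ be a non-empty, connected quasi-crystal of type $A_{n-1}$ whose quasi-crystal graph is bounded above and which satisfies the local quasi-crystal axioms LQ1, LQ2, LQ3 and LQ3$'$. Then $\mathcal{Q}$ has a unique highest weight element.
   Context: Fix $n\ge 2$, $I=\{1,\dots,n-1\}$, weight lattice $\mathbb{Z}^n$ with the standard inner product $\langle\cdot,\cdot\rangle$, and simple roots $\alpha_i=\mathbf{e}_i-\mathbf{e}_{i+1}$. On $\mathbb{Z}\sqcup\{-\infty,+\infty\}$ set $m+(\pm\infty)=(\pm\infty)+m=\pm\infty$ for $m\in\mathbb{Z}$. A quasi-crystal of type $A_{n-1}$ is a non-empty set $\mathcal{Q}$ with maps $\ddot e_i,\ddot f_i:\mathcal{Q}\to\mathcal{Q}\sqcup\{\bot\}$, $\ddot\varepsilon_i,\ddot\varphi_i:\mathcal{Q}\to\mathbb{Z}\sqcup\{-\infty,+\infty\}$ ($i\in I$) and $\mathrm{wt}:\mathcal{Q}\to\mathbb{Z}^n$ such that: (Q1) $\ddot e_i(x)=y$ iff $x=\ddot f_i(y)$, and then $\mathrm{wt}(y)=\mathrm{wt}(x)+\alpha_i$, $\ddot\varepsilon_i(y)=\ddot\varepsilon_i(x)-1$, $\ddot\varphi_i(y)=\ddot\varphi_i(x)+1$; (Q2) $\ddot\varphi_i(x)=\ddot\varepsilon_i(x)+\langle\mathrm{wt}(x),\alpha_i\rangle$; (Q3) if $\ddot\varepsilon_i(x)=-\infty$ then $\ddot e_i(x)=\ddot f_i(x)=\bot$; (Q4) if $\ddot\varepsilon_i(x)=+\infty$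 then $\ddot e_i(x)=\ddot f_i(x)=\bot$. Its quasi-crystal graph has vertex set $\mathcal{Q}$, an $i$-labelled edge $x\to y$ iff $\ddot f_i(x)=y$, and an $i$-labelled loop at $x$ iff $\ddot\varepsilon_i(x)=\ddot\varphi_i(x)=+\infty$; connected means this graph is connected. Local quasi-crystal axioms (for all $i,j\in I$, $x,y\in\mathcal{Q}$): (LQ1) if $i+1\in I$: $\ddot\varepsilon_i(x)=0\iff\ddot\varphi_{i+1}(x)=0$. (LQ2) if $\ddot e_i(x)=y$ then: (1) $\ddot\varepsilon_j(x)=\ddot\varepsilon_j(y)$ for $|i-j|>1$; (2) if $i+1\in I$: $\ddot\varepsilon_{i+1}(x)\ne\ddot\varepsilon_{i+1}(y)$ holds iff ($\ddot\varepsilon_{i+1}(x)=+\infty$ and $\ddot\varepsilon_i(y)=0$), and in that case $\ddot\varepsilon_{i+1}(y)\neq 0$; (3) if $i-1\in I$: $\ddot\varphi_{i-1}(x)\ne\ddot\varphi_{i-1}(y)$ holds iff ($\ddot\varphi_{i-1}(y)=+\infty$ and $\ddot\varphi_i(x)=0$), and in that case $\ddot\varphi_{i-1}(x)\ne 0$. (LQ3) if $i\ne j$ and $\ddot e_i(x)\neq\bot\neq\ddot e_j(x)$, then $\ddot e_i\ddot e_j(x)=\ddot e_j\ddot e_i(x)\neq\bot$. (LQ3$'$) same with $\ddot f$ in place of $\ddot e$. A highest weight element is $x$ with $\ddot e_i(x)=\bot$ for all $i\in I$. Write $x\prec y$ if $\ddot e_{i_1}\cdots\ddot e_{i_N}(x)=y$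 for some $N\ge1$ and $i_1,\dots,i_N\in I$; $\mathcal{Q}$ is bounded above if for every $x$ there is a highest weight element $x_h$ with $x\preceq x_h$. *)

theory Defs
  imports "HOL-Library.Extended" "Graph_Theory.Digraph_Component"
begin

definition index_set :: "nat \<Rightarrow> nat set" where
  "index_set n = {1..n - 1}"

text \<open>An element of \<open>\<int>\<^sup>n\<close> is a function on the naturals that vanishes outside \<open>{1..n}\<close>,
  so that equality of weights is equality of functions.\<close>

definition weight_lattice :: "nat \<Rightarrow> (nat \<Rightarrow> int) set" where
  "weight_lattice n = {v. \<forall>k. k \<notin> {1..n} \<longrightarrow> v k = 0}"

definition weight_inner :: "nat \<Rightarrow> (nat \<Rightarrow> int) \<Rightarrow> (nat \<Rightarrow> int) \<Rightarrow> int" where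
  "weight_inner n v w = (\<Sum>k = 1..n. v k * w k)"

definition unit_vec :: "nat \<Rightarrow> nat \<Rightarrow> int" where
  "unit_vec i = (\<lambda>k. if k = i then 1 else 0)"

definition simple_root :: "nat \<Rightarrow> nat \<Rightarrow> int" where
  "simple_root i = (\<lambda>k. unit_vec i k - unit_vec (i + 1) k)"

text \<open>The undefined value \<open>\<bottom>\<close> of the operators is \<^const>\<open>None\<close>.  The values of all maps at
  indices outside \<open>index_set n\<close> or at points outside the carrier \<open>elems\<close> are irrelevant.\<close>

record 'a qc_data =
  elems :: "'a set"
  e_op :: "nat \<Rightarrow> 'a \<Rightarrow> 'a option"
  f_op :: "nat \<Rightarrow> 'a \<Rightarrow> 'a option"
  eps :: "nat \<Rightarrow> 'a \<Rightarrow> int extended"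
  phi :: "nat \<Rightarrow> 'a \<Rightarrow> int extended"
  wt :: "'a \<Rightarrow> nat \<Rightarrow> int"

locale quasi_crystal =
  fixes n :: nat and Q :: "'a qc_data"
  assumes rank: "n \<ge> 2"
    and nonempty: "elems Q \<noteq> {}"
    and e_closed: "\<lbrakk>i \<in> index_set n; x \<in> elems Q; e_op Q i x = Some y\<rbrakk> \<Longrightarrow> y \<in> elems Q"
    and f_closed: "\<lbrakk>i \<in> index_set n; x \<in> elems Q; f_op Q i x = Some y\<rbrakk> \<Longrightarrow> y \<in> elems Q"
    and wt_closed: "x \<in> elems Q \<Longrightarrow> wt Q x \<in> weight_lattice n"
    and Q1_iff: "\<lbrakk>i \<in> index_set n; x \<in> elems Q; y \<in> elems Q\<rbrakk>
      \<Longrightarrow> e_op Q i x = Some y \<longleftrightarrow> f_op Q i y = Some x"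
    and Q1_wt: "\<lbrakk>i \<in> index_set n; x \<in> elems Q; y \<in> elems Q; e_op Q i x = Some y\<rbrakk>
      \<Longrightarrow> wt Q y = (\<lambda>k. wt Q x k + simple_root i k)"
    and Q1_eps: "\<lbrakk>i \<in> index_set n; x \<in> elems Q; y \<in> elems Q; e_op Q i x = Some y\<rbrakk>
      \<Longrightarrow> eps Q i y = eps Q i x - 1"
    and Q1_phi: "\<lbrakk>i \<in> index_set n; x \<in> elems Q; y \<in> elems Q; e_op Q i x = Some y\<rbrakk>
      \<Longrightarrow> phi Q i y = phi Q i x + 1"
    and Q2: "\<lbrakk>i \<in> index_set n; x \<in> elems Q\<rbrakk>
      \<Longrightarrow> phi Q i x = eps Q i x + Fin (weight_inner n (wt Q x) (simple_root i))"
    and Q3: "\<lbrakk>i \<in> index_set n; x \<in> elems Q; eps Q i x = Minf\<rbrakk>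
      \<Longrightarrow> e_op Q i x = None \<and> f_op Q i x = None"
    and Q4: "\<lbrakk>i \<in> index_set n; x \<in> elems Q; eps Q i x = Pinf\<rbrakk>
      \<Longrightarrow> e_op Q i x = None \<and> f_op Q i x = None"

text \<open>An arc \<open>(x, i, y)\<close> is an \<open>i\<close>-labelled edge from \<open>x\<close> to \<open>y\<close>.  The predicate
  \<^const>\<open>Digraph_Component.connected\<close> of the digraph library refers to the underlying undirected graph.\<close>

definition qc_graph :: "nat \<Rightarrow> 'a qc_data \<Rightarrow> ('a, 'a \<times> nat \<times> 'a) pre_digraph" where
  "qc_graph n Q = \<lparr>
     verts = elems Q,
     arcs = {(x, i, y). x \<in> elems Q \<and> y \<in> elems Q \<and> i \<in> index_set n \<and> f_op Q i x = Some y}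
          \<union> {(x, i, y). x \<in> elems Q \<and> y = x \<and> i \<in> index_set n \<and>
               eps Q i x = Pinf \<and> phi Q i x = Pinf},
     tail = (\<lambda>(x, i, y). x),
     head = (\<lambda>(x, i, y). y)\<rparr>"

definition LQ1 :: "nat \<Rightarrow> 'a qc_data \<Rightarrow> bool" where
  "LQ1 n Q \<longleftrightarrow> (\<forall>i \<in> index_set n. \<forall>x \<in> elems Q.
     i + 1 \<in> index_set n \<longrightarrow> (eps Q i x = 0 \<longleftrightarrow> phi Q (i + 1) x = 0))"

text \<open>Natural-number subtraction is harmless in the third clause: for \<open>i = 1\<close> the index
  \<open>i - 1 = 0\<close> is not in \<open>index_set n\<close>.\<close>

definition LQ2 :: "nat \<Rightarrow> 'a qc_data \<Rightarrow> bool" where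
  "LQ2 n Q \<longleftrightarrow> (\<forall>i \<in> index_set n. \<forall>x \<in> elems Q. \<forall>y \<in> elems Q. e_op Q i x = Some y \<longrightarrow>
     (\<forall>j \<in> index_set n. \<bar>int i - int j\<bar> > 1 \<longrightarrow> eps Q j x = eps Q j y) \<and>
     (i + 1 \<in> index_set n \<longrightarrow>
       (eps Q (i + 1) x \<noteq> eps Q (i + 1) y \<longleftrightarrow> eps Q (i + 1) x = Pinf \<and> eps Q i y = 0) \<and>
       (eps Q (i + 1) x \<noteq> eps Q (i + 1) y \<longrightarrow> eps Q (i + 1) y \<noteq> 0)) \<and>
     (i - 1 \<in> index_set n \<longrightarrow>
       (phi Q (i - 1) x \<noteq> phi Q (i - 1) y \<longleftrightarrow> phi Q (i - 1) y = Pinf \<and> phi Q i x = 0) \<and>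
       (phi Q (i - 1) x \<noteq> phi Q (i - 1) y \<longrightarrow> phi Q (i - 1) x \<noteq> 0)))"

definition LQ3 :: "nat \<Rightarrow> 'a qc_data \<Rightarrow> bool" where
  "LQ3 n Q \<longleftrightarrow> (\<forall>i \<in> index_set n. \<forall>j \<in> index_set n. \<forall>x \<in> elems Q.
     i \<noteq> j \<and> e_op Q i x \<noteq> None \<and> e_op Q j x \<noteq> None \<longrightarrow>
     Option.bind (e_op Q j x) (e_op Q i) = Option.bind (e_op Q i x) (e_op Q j) \<and>
     Option.bind (e_op Q i x) (e_op Q j) \<noteq> None)"

definition LQ3' :: "nat \<Rightarrow> 'a qc_data \<Rightarrow> bool" where
  "LQ3' n Q \<longleftrightarrow> (\<forall>i \<in> index_set n. \<forall>j \<in> index_set n. \<forall>x \<in> elems Q.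
     i \<noteq> j \<and> f_op Q i x \<noteq> None \<and> f_op Q j x \<noteq> None \<longrightarrow>
     Option.bind (f_op Q j x) (f_op Q i) = Option.bind (f_op Q i x) (f_op Q j) \<and>
     Option.bind (f_op Q i x) (f_op Q j) \<noteq> None)"

definition highest_weight :: "nat \<Rightarrow> 'a qc_data \<Rightarrow> 'a \<Rightarrow> bool" where
  "highest_weight n Q x \<longleftrightarrow> x \<in> elems Q \<and> (\<forall>i \<in> index_set n. e_op Q i x = None)"

text \<open>\<open>e_word Q [i\<^sub>1, \<dots>, i\<^sub>N] x\<close> is the composite of the operators with the rightmost letter
  acting first.\<close>

fun e_word :: "'a qc_data \<Rightarrow> nat list \<Rightarrow> 'a \<Rightarrow> 'a option" where
  "e_word Q [] x = Some x"
| "e_word Q (i # w) x = Option.bind (e_word Q w x) (e_op Q i)"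

definition qc_less :: "nat \<Rightarrow> 'a qc_data \<Rightarrow> 'a \<Rightarrow> 'a \<Rightarrow> bool" where
  "qc_less n Q x y \<longleftrightarrow> (\<exists>w. w \<noteq> [] \<and> set w \<subseteq> index_set n \<and> e_word Q w x = Some y)"

definition qc_le :: "nat \<Rightarrow> 'a qc_data \<Rightarrow> 'a \<Rightarrow> 'a \<Rightarrow> bool" where
  "qc_le n Q x y \<longleftrightarrow> x = y \<or> qc_less n Q x y"

definition bounded_above :: "nat \<Rightarrow> 'a qc_data \<Rightarrow> bool" where
  "bounded_above n Q \<longleftrightarrow> (\<forall>x \<in> elems Q. \<exists>h. highest_weight n Q h \<and> qc_le n Q x h)"

end

theory Submission
  imports Defs "HOL-Library.Confluence"
begin

text \<open>Axiom LQ3 gives the diamond property for the relation of raising an element by one of the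
  operators, so this relation is confluent, and the highest weight elements are its normal forms.
  Connectedness makes any two elements equivalent under the equivalence closure of raising, and
  equivalent normal forms of a confluent relation are equal.\<close>

lemma confluentp_normal_forms_eq:
  assumes "confluentp r" and "equivclp r x y"
    and "\<not> Domainp r x" and "\<not> Domainp r y"
  shows "x = y"
proof -
  have "semiconfluentp r"
    using \<open>confluentp r\<close> by (rule confluentp_imp_semiconfluentp)
  with \<open>equivclp r x y\<close> obtain u where "r\<^sup>*\<^sup>* x u" and "r\<^sup>*\<^sup>* y u"
    by (auto simp: semiconfluentp_equivclp rtranclp_conversep)
  with \<open>\<not> Domainp r x\<close> \<open>\<not> Domainp r y\<close> show ?thesis
    by (simp add: Not_Domain_rtrancl[to_pred])
qed

lemma connected_imp_equivclp_dominates: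
  assumes "Digraph_Component.connected G" and "u \<in> verts G" and "v \<in> verts G"
  shows "equivclp (dominates G) u v"
proof -
  have "u \<rightarrow>\<^sup>*\<^bsub>mk_symmetric G\<^esub> v"
    using assms by (auto simp: connected_def elim: strongly_connectedE)
  then have "(u, v) \<in> (parcs (mk_symmetric G))\<^sup>*"
    by (auto dest: reachable_rtranclI)
  moreover have "parcs (mk_symmetric G) = {(a, b). symclp (dominates G) a b}"
    by (auto simp: parcs_mk_symmetric arcs_ends_conv symclp_def)
  ultimately show ?thesis
    by (simp add: equivclp_def rtranclp_rtrancl_eq)
qed

definition raises :: "nat \<Rightarrow> 'a qc_data \<Rightarrow> 'a \<Rightarrow> 'a \<Rightarrow> bool" where
  "raises n Q x y \<longleftrightarrow> x \<in> elems Q \<and> (\<exists>i \<in> index_set n. e_op Q i x = Some y)"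

lemma highest_weight_iff_not_Domainp_raises:
  "highest_weight n Q x \<longleftrightarrow> x \<in> elems Q \<and> \<not> Domainp (raises n Q) x"
  by (auto simp: highest_weight_def raises_def Domainp_iff simp flip: not_Some_eq)

lemma LQ3_diamond:
  assumes "LQ3 n Q" and "i \<in> index_set n" and "j \<in> index_set n" and "x \<in> elems Q"
    and "i \<noteq> j" and "e_op Q i x = Some y" and "e_op Q j x = Some z"
  obtains u where "e_op Q j y = Some u" and "e_op Q i z = Some u"
  using \<open>LQ3 n Q\<close>[unfolded LQ3_def, rule_format, of i j x] assms(2-) by auto

context quasi_crystal
begin

lemma strong_confluentp_raises:
  assumes "LQ3 n Q"
  shows "strong_confluentp (raises n Q)"
proof
  fix x y z
  assume "raises n Q x y" and "raises n Q x z"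
  then obtain i j where x: "x \<in> elems Q" and i: "i \<in> index_set n" and j: "j \<in> index_set n"
    and y: "e_op Q i x = Some y" and z: "e_op Q j x = Some z"
    unfolding raises_def by blast
  show "\<exists>u. (raises n Q)\<^sup>*\<^sup>* y u \<and> (raises n Q)\<^sup>=\<^sup>= z u"
  proof (cases "i = j")
    case True
    with y z show ?thesis by auto
  next
    case False
    with assms i j x y z obtain u where "e_op Q j y = Some u" and "e_op Q i z = Some u"
      by (blast elim: LQ3_diamond)
    moreover have "y \<in> elems Q" and "z \<in> elems Q"
      using e_closed i j x y z by blast+
    ultimately have "raises n Q y u" and "raises n Q z u"
      using i j unfolding raises_def by blast+
    then show ?thesis by blast
  qed
qed

lemma dominates_qc_graphD:
  assumes "x \<rightarrow>\<^bsub>qc_graph n Q\<^esub> y"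
  shows "x = y \<or> raises n Q y x"
  using assms Q1_iff by (fastforce simp: qc_graph_def arcs_ends_conv raises_def)

lemma connected_imp_equivclp_raises:
  assumes "Digraph_Component.connected (qc_graph n Q)" and "x \<in> elems Q" and "y \<in> elems Q"
  shows "equivclp (raises n Q) x y"
proof -
  have "equivclp (dominates (qc_graph n Q)) x y"
    using assms by (intro connected_imp_equivclp_dominates) (simp_all add: qc_graph_def)
  then show ?thesis
    by induction (auto dest: dominates_qc_graphD intro: equivclp_into_equivclp)
qed

lemma highest_weight_unique:
  assumes "LQ3 n Q" and "Digraph_Component.connected (qc_graph n Q)"
    and "highest_weight n Q x" and "highest_weight n Q y"
  shows "x = y"
proof (rule confluentp_normal_forms_eq)
  show "confluentp (raises n Q)"
    using \<open>LQ3 n Q\<close> by (intro strong_confluentp_imp_confluentp strong_confluentp_raises)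
  show "equivclp (raises n Q) x y"
    using assms(2-4) by (auto simp: highest_weight_def intro: connected_imp_equivclp_raises)
qed (use assms(3,4) in \<open>simp_all add: highest_weight_iff_not_Domainp_raises\<close>)

end

theorem theorem3p7:
  fixes n :: nat and Q :: "'a qc_data"
  assumes "quasi_crystal n Q"
    and "Digraph_Component.connected (qc_graph n Q)"
    and "bounded_above n Q"
    and "LQ1 n Q" and "LQ2 n Q" and "LQ3 n Q" and "LQ3' n Q"
  shows "\<exists>!x. highest_weight n Q x"
proof (rule ex_ex1I)
  interpret quasi_crystal n Q by fact
  show "\<exists>x. highest_weight n Q x"
    using nonempty \<open>bounded_above n Q\<close> unfolding bounded_above_def by blast
  show "x = y" if "highest_weight n Q x" and "highest_weight n Q y" for x y
    using \<open>LQ3 n Q\<close> \<open>Digraph_Component.connected (qc_graph n Q)\<close> that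
    by (rule highest_weight_unique)
qed

end
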